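(* Let $\Bbbk$ be a field of characteristic $0$ and let $\mathfrak{g}$ be an infinite-dimensional graded Lie subalgebra of $W_{\geq -1} = \operatorname{Der}(\Bbbk[t])$. Then $U(\mathfrak{g})$ is not noetherian.
   Context: $W_{\geq -1} = \operatorname{Der}(\Bbbk[t]) = \Bbbk[t]\partial$, where $\partial$ is differentiation with respect to $t$, with Lie bracket $[f\partial, g\partial] = (fg' - f'g)\partial$. It has basis $e_n = t^{n+1}\partial$ ($n \geq -1$), with $[e_n,e_m] = (m-n)e_{n+m}$, and is graded by declaring $e_n$ to be homogeneous of degree $n$. A graded Lie subalgebra is one that is spanned by homogeneous elements with respect to this grading. $U(\mathfrak{g})$ is the universal enveloping algebra. Noetherian means left and right noetherian (equivalent to each other for universal enveloping algebras). *)

theory Defs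
  imports
    "HOL-Computational_Algebra.Polynomial"
    "HOL-Library.Poly_Mapping"
    "HOL-Algebra.QuotRing"
begin

section \<open>The Lie algebra of derivations of a polynomial ring\<close>

interpretation poly_vs: vector_space "smult :: 'k::field \<Rightarrow> 'k poly \<Rightarrow> 'k poly"
  by unfold_locales (simp_all add: smult_add_right smult_add_left)

text \<open>
  The polynomial \<open>f\<close> stands for the vector field \<open>f\<partial>\<close>, so that \<open>'k poly\<close> is the vector space
  \<open>k[t]\<partial>\<close>. The lemmas \<open>derivation_iff\<close> and \<open>vector_field_witt_bracket\<close> identify it, as a Lie algebra,
  with the derivations of \<open>k[t]\<close> under the commutator.
\<close>

definition witt_bracket :: "'k::field_char_0 poly \<Rightarrow> 'k poly \<Rightarrow> 'k poly"
  where "witt_bracket f g = f * pderiv g - pderiv f * g"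

definition vector_field :: "'k::field_char_0 poly \<Rightarrow> 'k poly \<Rightarrow> 'k poly"
  where "vector_field f p = f * pderiv p"

definition derivation :: "('k::field_char_0 poly \<Rightarrow> 'k poly) \<Rightarrow> bool"
  where "derivation D \<longleftrightarrow>
    (\<forall>p q. D (p + q) = D p + D q) \<and> (\<forall>c p. D (smult c p) = smult c (D p)) \<and>
    (\<forall>p q. D (p * q) = D p * q + p * D q)"

lemma derivation_vector_field: "derivation (vector_field f)"
  by (simp add: derivation_def vector_field_def pderiv_add pderiv_mult pderiv_smult algebra_simps)

lemma derivation_iff: "derivation D \<longleftrightarrow> (\<exists>!f. D = vector_field f)"
proof
  assume D: "derivation D"
  have add: "D (p + q) = D p + D q" and scale: "D (smult c p) = smult c (D p)"
    and prod: "D (p * q) = D p * q + p * D q" for p q c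
    using D by (auto simp: derivation_def)
  have one: "D 1 = 0" using prod[of 1 1] by simp
  have const: "D [:c:] = 0" for c using scale[of c 1] one by simp
  let ?f = "D [:0, 1:]"
  have "D p = vector_field ?f p" for p
  proof (induction p)
    case 0
    then show ?case using add[of 0 0] by (simp add: vector_field_def)
  next
    case (pCons a p)
    have "pCons a p = [:a:] + [:0, 1:] * p" by simp
    then have "D (pCons a p) = D ([:a:] + [:0, 1:] * p)" by simp
    also have "\<dots> = ?f * p + [:0, 1:] * D p" by (simp only: add prod const) simp
    finally show ?case
      using pCons.IH by (simp add: vector_field_def pderiv_pCons algebra_simps)
  qed
  moreover have "f = ?f" if "D = vector_field f" for f
    using that by (simp add: vector_field_def pderiv_pCons)
  ultimately show "\<exists>!f. D = vector_field f" by blast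
next
  assume "\<exists>!f. D = vector_field f"
  then show "derivation D" using derivation_vector_field by blast
qed

lemma vector_field_witt_bracket:
  "vector_field (witt_bracket f g) p =
     vector_field f (vector_field g p) - vector_field g (vector_field f p)"
  by (simp add: vector_field_def witt_bracket_def pderiv_mult algebra_simps)

text \<open>The basis vector of degree \<open>n\<close>, meaningful only for \<open>n \<ge> -1\<close>.\<close>

definition witt_e :: "int \<Rightarrow> 'k::field_char_0 poly"
  where "witt_e n = monom 1 (nat (n + 1))"

lemma witt_bracket_e:
  assumes "n \<ge> -1" "m \<ge> -1"
  shows "witt_bracket (witt_e n) (witt_e m) = smult (of_int (m - n)) (witt_e (n + m) :: 'k::field_char_0 poly)"
proof (cases "n + m \<ge> -1")
  case False
  then have "n = -1" "m = -1" using assms by auto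
  then show ?thesis by (simp add: witt_bracket_def)
next
  case True
  define a b where "a = nat (n + 1)" and "b = nat (m + 1)"
  have n: "n = int a - 1" and m: "m = int b - 1"
    using assms by (auto simp: a_def b_def)
  have ab: "a + b \<ge> 1" "nat (n + m + 1) = a + b - 1" using assms True by (auto simp: n m)
  have "a + (b - 1) = a + b - 1" if "b > 0" using that by simp
  moreover have "a - 1 + b = a + b - 1" if "a > 0" using that by simp
  ultimately have "witt_bracket (monom 1 a) (monom 1 b) =
      monom (of_nat b - of_nat a :: 'k) (a + b - 1)"
    by (cases "a = 0"; cases "b = 0")
       (auto simp: witt_bracket_def pderiv_monom mult_monom diff_monom minus_monom)
  then show ?thesis
    using ab by (simp add: witt_e_def smult_monom n m)
qed

definition homogeneous :: "int \<Rightarrow> 'k::field_char_0 poly \<Rightarrow> bool"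
  where "homogeneous n f \<longleftrightarrow> n \<ge> -1 \<and> (\<exists>c. f = smult c (witt_e n))"

definition lie_subalgebra :: "'k::field_char_0 poly set \<Rightarrow> bool"
  where "lie_subalgebra \<gg> \<longleftrightarrow>
    poly_vs.subspace \<gg> \<and> (\<forall>f\<in>\<gg>. \<forall>g\<in>\<gg>. witt_bracket f g \<in> \<gg>)"

definition graded_lie_subalgebra :: "'k::field_char_0 poly set \<Rightarrow> bool"
  where "graded_lie_subalgebra \<gg> \<longleftrightarrow>
    lie_subalgebra \<gg> \<and> poly_vs.span {f \<in> \<gg>. \<exists>n. homogeneous n f} = \<gg>"

definition finite_dimensional :: "'k::field_char_0 poly set \<Rightarrow> bool"
  where "finite_dimensional V \<longleftrightarrow> (\<exists>B\<subseteq>V. finite B \<and> poly_vs.span B = V)"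


section \<open>Universal enveloping algebras\<close>

text \<open>
  The free associative unital algebra on a type of generators consists of the finitely supported
  functions on the free monoid of words; the multiplication of \<open>poly_mapping\<close> is then convolution
  along concatenation.
\<close>

datatype (letters: 'a) free_monoid = Word "'a list"

instantiation free_monoid :: (type) monoid_add
begin

definition zero_free_monoid :: "'a free_monoid"
  where "zero_free_monoid = Word []"

fun plus_free_monoid :: "'a free_monoid \<Rightarrow> 'a free_monoid \<Rightarrow> 'a free_monoid"
  where "plus_free_monoid (Word u) (Word v) = Word (u @ v)"

instance
proof
  fix a b c :: "'a free_monoid"
  show "a + b + c = a + (b + c)" by (cases a; cases b; cases c) simp
  show "0 + a = a" "a + 0 = a" by (cases a; simp add: zero_free_monoid_def)+
qed

end

lemma letters_zero [simp]: "letters 0 = {}"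
  by (simp add: zero_free_monoid_def)

lemma letters_plus [simp]: "letters (u + v) = letters u \<union> letters v"
  by (cases u; cases v) simp

definition free_alg :: "'a set \<Rightarrow> ('a free_monoid \<Rightarrow>\<^sub>0 'k::field) ring"
  where "free_alg X =
    \<lparr>carrier = {p. \<forall>w\<in>Poly_Mapping.keys p. letters w \<subseteq> X},
     mult = (*), one = 1, zero = 0, add = (+)\<rparr>"

definition gen :: "'a \<Rightarrow> ('a free_monoid \<Rightarrow>\<^sub>0 'k::field)"
  where "gen x = Poly_Mapping.single (Word [x]) 1"

definition scalar :: "'k::field \<Rightarrow> ('a free_monoid \<Rightarrow>\<^sub>0 'k)"
  where "scalar c = Poly_Mapping.single 0 c"

text \<open>
  For a Lie algebra with underlying set \<open>L\<close>, scalar multiplication \<open>scale\<close> and bracket \<open>br\<close>: dividing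
  the free algebra on the set \<open>L\<close> by the first two families of relations gives the tensor algebra
  of \<open>L\<close>, and the third family is the usual \<open>x \<otimes> y - y \<otimes> x - [x, y]\<close>.
\<close>

definition uea_relations ::
    "('k::field \<Rightarrow> 'a::ab_group_add \<Rightarrow> 'a) \<Rightarrow> ('a \<Rightarrow> 'a \<Rightarrow> 'a) \<Rightarrow> 'a set \<Rightarrow> ('a free_monoid \<Rightarrow>\<^sub>0 'k) set"
  where "uea_relations scale br L =
    {gen (x + y) - gen x - gen y | x y. x \<in> L \<and> y \<in> L} \<union>
    {gen (scale c x) - scalar c * gen x | c x. x \<in> L} \<union>
    {gen x * gen y - gen y * gen x - gen (br x y) | x y. x \<in> L \<and> y \<in> L}"

definition uea ::
    "('k::field \<Rightarrow> 'a::ab_group_add \<Rightarrow> 'a) \<Rightarrow> ('a \<Rightarrow> 'a \<Rightarrow> 'a) \<Rightarrow> 'a set \<Rightarrow> ('a free_monoid \<Rightarrow>\<^sub>0 'k) set ring"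
  where "uea scale br L = free_alg L Quot (Idl\<^bsub>free_alg L\<^esub> (uea_relations scale br L))"

lemma free_alg_mult_closed:
  assumes "p \<in> carrier (free_alg X)" "q \<in> carrier (free_alg X)"
  shows "p * q \<in> carrier (free_alg X)"
proof -
  have "letters w \<subseteq> X" if w: "w \<in> Poly_Mapping.keys (p * q)" for w
  proof -
    obtain u v where "w = u + v" "u \<in> Poly_Mapping.keys p" "v \<in> Poly_Mapping.keys q"
      using w keys_mult[of p q] by blast
    then show ?thesis using assms by (simp add: free_alg_def)
  qed
  then show ?thesis by (simp add: free_alg_def)
qed

lemma free_alg_diff_closed:
  assumes "p \<in> carrier (free_alg X)" "q \<in> carrier (free_alg X)"
  shows "p - q \<in> carrier (free_alg X)"
  using assms keys_diff[of p q] by (auto simp: free_alg_def)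

lemma ring_free_alg: "ring (free_alg X :: ('a free_monoid \<Rightarrow>\<^sub>0 'k::field) ring)"
proof (rule ringI)
  let ?F = "free_alg X :: ('a free_monoid \<Rightarrow>\<^sub>0 'k) ring"
  have minus: "\<exists>y\<in>carrier ?F. y \<oplus>\<^bsub>?F\<^esub> x = \<zero>\<^bsub>?F\<^esub>" if "x \<in> carrier ?F" for x
    using that by (intro bexI[of _ "- x"]) (auto simp: free_alg_def)
  show "abelian_group ?F"
    using minus
    by (intro abelian_groupI) (use Poly_Mapping.keys_add in \<open>fastforce simp: free_alg_def algebra_simps\<close>)+
  show "Group.monoid ?F"
  proof (rule monoidI)
    show "x \<otimes>\<^bsub>?F\<^esub> y \<in> carrier ?F" if "x \<in> carrier ?F" "y \<in> carrier ?F" for x y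
      using free_alg_mult_closed[OF that] by (simp add: free_alg_def)
  qed (simp_all add: free_alg_def mult.assoc)
  show "(x \<oplus>\<^bsub>?F\<^esub> y) \<otimes>\<^bsub>?F\<^esub> z = x \<otimes>\<^bsub>?F\<^esub> z \<oplus>\<^bsub>?F\<^esub> y \<otimes>\<^bsub>?F\<^esub> z" for x y z
    by (simp add: free_alg_def distrib_right)
  show "z \<otimes>\<^bsub>?F\<^esub> (x \<oplus>\<^bsub>?F\<^esub> y) = z \<otimes>\<^bsub>?F\<^esub> x \<oplus>\<^bsub>?F\<^esub> z \<otimes>\<^bsub>?F\<^esub> y" for x y z
    by (simp add: free_alg_def distrib_left)
qed

lemma gen_closed: "x \<in> X \<Longrightarrow> gen x \<in> carrier (free_alg X)"
  by (simp add: free_alg_def gen_def)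

lemma scalar_closed: "scalar c \<in> carrier (free_alg X)"
  by (simp add: free_alg_def scalar_def)

lemma uea_relations_carrier:
  assumes "\<And>x y. x \<in> L \<Longrightarrow> y \<in> L \<Longrightarrow> x + y \<in> L" "\<And>c x. x \<in> L \<Longrightarrow> scale c x \<in> L"
    and "\<And>x y. x \<in> L \<Longrightarrow> y \<in> L \<Longrightarrow> br x y \<in> L"
  shows "uea_relations scale br L \<subseteq> carrier (free_alg L)"
  unfolding uea_relations_def
  by (safe; intro free_alg_diff_closed free_alg_mult_closed gen_closed scalar_closed assms)

lemma ring_uea:
  assumes "\<And>x y. x \<in> L \<Longrightarrow> y \<in> L \<Longrightarrow> x + y \<in> L" "\<And>c x. x \<in> L \<Longrightarrow> scale c x \<in> L"
    and "\<And>x y. x \<in> L \<Longrightarrow> y \<in> L \<Longrightarrow> br x y \<in> L"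
  shows "ring (uea scale br L)"
  unfolding uea_def
  by (intro ideal.quotient_is_ring ring.genideal_ideal ring_free_alg uea_relations_carrier assms)


section \<open>Noetherian rings\<close>

text \<open>The rings here are not commutative, and the ideals of \<open>HOL-Algebra\<close> are two-sided.\<close>

definition left_ideal :: "('a, 'b) ring_scheme \<Rightarrow> 'a set \<Rightarrow> bool"
  where "left_ideal R I \<longleftrightarrow>
    additive_subgroup I R \<and> (\<forall>r\<in>carrier R. \<forall>x\<in>I. r \<otimes>\<^bsub>R\<^esub> x \<in> I)"

definition right_ideal :: "('a, 'b) ring_scheme \<Rightarrow> 'a set \<Rightarrow> bool"
  where "right_ideal R I \<longleftrightarrow>
    additive_subgroup I R \<and> (\<forall>r\<in>carrier R. \<forall>x\<in>I. x \<otimes>\<^bsub>R\<^esub> r \<in> I)"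

definition left_noetherian :: "('a, 'b) ring_scheme \<Rightarrow> bool"
  where "left_noetherian R \<longleftrightarrow>
    (\<forall>I :: nat \<Rightarrow> 'a set. (\<forall>n. left_ideal R (I n)) \<and> (\<forall>n. I n \<subseteq> I (Suc n)) \<longrightarrow>
      (\<exists>N. \<forall>n\<ge>N. I n = I N))"

definition right_noetherian :: "('a, 'b) ring_scheme \<Rightarrow> bool"
  where "right_noetherian R \<longleftrightarrow>
    (\<forall>I :: nat \<Rightarrow> 'a set. (\<forall>n. right_ideal R (I n)) \<and> (\<forall>n. I n \<subseteq> I (Suc n)) \<longrightarrow>
      (\<exists>N. \<forall>n\<ge>N. I n = I N))"

definition noetherian :: "('a, 'b) ring_scheme \<Rightarrow> bool"
  where "noetherian R \<longleftrightarrow> left_noetherian R \<and> right_noetherian R"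

end

theory Submission
  imports Defs "HOL-Computational_Algebra.Formal_Laurent_Series"
begin

text \<open>
  Write \<open>\<theta> = t d/dt\<close> and let \<open>a\<close> be a formal parameter. The vector field \<open>f\<partial> = h\<theta>\<close>, where \<open>h = f/t\<close>,
  acts on the Laurent series in \<open>t\<close> over \<open>k[a]\<close> by \<open>v \<mapsto> \<theta>(h v) + a \<theta>(h) v\<close>. This is a one-parameter
  family of modules of tensor densities, and on monomials it reads
  \<open>e\<^sub>n t\<^sup>m = (m + n + n a) t\<^sup>m\<^sup>+\<^sup>n\<close>. The first summand, a \<open>\<theta>\<close>-derivative, has no constant
  coefficient. So the constant coefficient of any \<open>e\<^sub>n v\<close> is a multiple of \<open>a\<close>, and the series that
  are divisible by \<open>a\<close> and have a constant coefficient divisible by \<open>a\<^sup>2\<close> form a submodule \<open>K\<close>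
  (\<open>critical\<close> below; lemma \<open>critical_density\<close>).

  The coefficient of \<open>e\<^sub>i e\<^sub>N\<^sub>-\<^sub>i t\<^sup>m\<close> is a quadratic polynomial in \<open>i\<close> with leading coefficient
  \<open>-a(1 + a)\<close>. A second difference \<open>s\<^sub>N\<close> of the products \<open>e\<^sub>i e\<^sub>N\<^sub>-\<^sub>i\<close> in the variable \<open>i\<close>
  therefore sends every \<open>t\<^sup>m\<close> to a nonzero scalar times \<open>a(1 + a) t\<^sup>N\<^sup>+\<^sup>m\<close>
  (\<open>act_second_difference\<close>). This lies in \<open>K\<close> unless \<open>m = -N\<close>, since \<open>a(1 + a)\<close> vanishes only to
  first order at \<open>a = 0\<close>. Consequently the increasing left ideals
  \<open>L\<^sub>n = {u. u t\<^sup>-\<^sup>j \<in> K for all j > n}\<close> of the enveloping algebra satisfy \<open>s\<^sub>N \<in> L\<^sub>N\<close> but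
  \<open>s\<^sub>N \<notin> L\<^sub>n\<close> for \<open>n < N\<close>, and the chain is not stationary as soon as \<open>s\<^sub>N\<close> is available for
  infinitely many \<open>N\<close>.

  An infinite-dimensional graded subalgebra contains \<open>e\<^sub>p\<close> and \<open>e\<^sub>q\<close> for distinct positive \<open>p\<close> and
  \<open>q\<close>, hence \<open>e\<^sub>p\<^sub>+\<^sub>k\<^sub>q\<close> for all \<open>k\<close> (\<open>arithmetic_progression_of_degrees\<close>). Differences with step
  \<open>q\<close> along this progression give \<open>s\<^sub>N\<close> for all \<open>N = 2p + (k + 2)q\<close>.

  The left ideals \<open>L\<^sub>n\<close> are constructed in the free algebra on the subalgebra. They contain the
  ideal of relations of the enveloping algebra, because this ideal acts by zero, and so the chain can
  be transported along the quotient map.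
\<close>

unbundle fps_syntax

section \<open>Modules over the free algebra\<close>

lemma free_alg_ops:
  "p \<oplus>\<^bsub>free_alg X\<^esub> q = p + q" "p \<otimes>\<^bsub>free_alg X\<^esub> q = p * q" "\<zero>\<^bsub>free_alg X\<^esub> = 0"
  by (simp_all add: free_alg_def)

lemma free_alg_add_closed:
  assumes "p \<in> carrier (free_alg X)" "q \<in> carrier (free_alg X)"
  shows "p + q \<in> carrier (free_alg X)"
  using ring.ring_simprules(1)[OF ring_free_alg assms] by (simp add: free_alg_ops)

lemma free_alg_uminus_closed:
  "p \<in> carrier (free_alg X) \<Longrightarrow> - p \<in> carrier (free_alg X)"
  by (simp add: free_alg_def)

lemma free_alg_subgroupI:
  fixes I :: "('a free_monoid \<Rightarrow>\<^sub>0 'k::field) set"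
  assumes I: "I \<subseteq> carrier (free_alg X)" and "0 \<in> I"
    and uminus: "\<And>p. p \<in> I \<Longrightarrow> - p \<in> I" and "\<And>p q. p \<in> I \<Longrightarrow> q \<in> I \<Longrightarrow> p + q \<in> I"
  shows "subgroup I (add_monoid (free_alg X))"
proof -
  let ?F = "free_alg X :: ('a free_monoid \<Rightarrow>\<^sub>0 'k) ring"
  interpret F: ring ?F by (rule ring_free_alg)
  have inv: "\<ominus>\<^bsub>?F\<^esub> p = - p" if "p \<in> I" for p
    by (rule F.minus_equality) (use that I uminus in \<open>auto simp: free_alg_ops\<close>)
  show ?thesis
    by (rule F.add.subgroupI)
      (use assms inv in \<open>auto simp: free_alg_ops a_inv_def[symmetric]\<close>)
qed

text \<open>
  Any assignment of linear operators to the generators makes a vector space a module over the free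
  algebra.
\<close>

locale generator_action = vector_space scale
  for scale :: "'k::field \<Rightarrow> 'v::ab_group_add \<Rightarrow> 'v" +
  fixes \<rho> :: "'a::ab_group_add \<Rightarrow> 'v \<Rightarrow> 'v"
  assumes \<rho>_add: "\<rho> x (v + w) = \<rho> x v + \<rho> x w"
    and \<rho>_scale: "\<rho> x (scale c v) = scale c (\<rho> x v)"
begin

fun word_act :: "'a free_monoid \<Rightarrow> 'v \<Rightarrow> 'v"
  where "word_act (Word w) v = foldr \<rho> w v"

definition act :: "('a free_monoid \<Rightarrow>\<^sub>0 'k) \<Rightarrow> 'v \<Rightarrow> 'v"
  where "act p v = (\<Sum>w\<in>Poly_Mapping.keys p. scale (Poly_Mapping.lookup p w) (word_act w v))"

lemma word_act_plus: "word_act (u + w) v = word_act u (word_act w v)"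
  by (cases u; cases w) simp

lemma word_act_add: "word_act u (v + w) = word_act u v + word_act u w"
proof (cases u)
  case (Word xs)
  have "foldr \<rho> xs (v + w) = foldr \<rho> xs v + foldr \<rho> xs w"
    by (induction xs) (simp_all add: \<rho>_add)
  then show ?thesis by (simp add: Word)
qed

lemma word_act_scale: "word_act u (scale c v) = scale c (word_act u v)"
proof (cases u)
  case (Word xs)
  have "foldr \<rho> xs (scale c v) = scale c (foldr \<rho> xs v)"
    by (induction xs) (simp_all add: \<rho>_scale)
  then show ?thesis by (simp add: Word)
qed

lemma act_superset:
  assumes "finite A" "Poly_Mapping.keys p \<subseteq> A"
  shows "act p v = (\<Sum>w\<in>A. scale (Poly_Mapping.lookup p w) (word_act w v))"
  unfolding act_def using assms
  by (intro sum.mono_neutral_left) (auto simp: in_keys_iff)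

lemma act_zero [simp]: "act 0 v = 0"
  by (simp add: act_def)

lemma act_plus: "act (p + q) v = act p v + act q v"
proof -
  let ?A = "Poly_Mapping.keys p \<union> Poly_Mapping.keys q"
  have "act r v = (\<Sum>w\<in>?A. scale (Poly_Mapping.lookup r w) (word_act w v))"
    if "r \<in> {p, q, p + q}" for r
    by (rule act_superset) (use that Poly_Mapping.keys_add[of p q] in auto)
  then show ?thesis
    by (simp add: lookup_add scale_left_distrib sum.distrib)
qed

lemma act_minus: "act (p - q) v = act p v - act q v"
  using act_plus[of "p - q" q v] by (simp add: algebra_simps)

lemma act_uminus: "act (- p) v = - act p v"
  using act_minus[of 0 p v] by simp

lemma act_single: "act (Poly_Mapping.single w c) v = scale c (word_act w v)"
  by (cases "c = 0") (simp_all add: act_def)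

lemma act_gen [simp]: "act (gen x) v = \<rho> x v"
  by (simp add: gen_def act_single)

lemma act_scalar [simp]: "act (scalar c) v = scale c v"
  by (simp add: scalar_def act_single zero_free_monoid_def)

lemma act_vector_add: "act p (v + w) = act p v + act p w"
  by (simp add: act_def word_act_add scale_right_distrib sum.distrib)

lemma act_vector_zero [simp]: "act p 0 = 0"
  using act_vector_add[of p 0 0] by simp

text \<open>
  Every element of the free algebra is a sum of multiples of words, which allows identities that
  are additive to be checked on words.
\<close>

lemma free_alg_induct [case_names zero single plus]:
  fixes p :: "'a free_monoid \<Rightarrow>\<^sub>0 'k"
  assumes "P 0" and "\<And>w c. P (Poly_Mapping.single w c)"
    and "\<And>p q. P p \<Longrightarrow> P q \<Longrightarrow> P (p + q)"
  shows "P p"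
proof (induction p rule: update_induct)
  case const
  show ?case by (rule assms(1))
next
  case (update p w c)
  have "Poly_Mapping.update w c p = Poly_Mapping.single w c + p"
    using update(1)
    by (intro poly_mapping_eqI)
       (auto simp: lookup_update lookup_add lookup_single in_keys_iff when_def)
  then show ?case using assms(2,3) update(3) by simp
qed

lemma act_mult: "act (p * q) v = act p (act q v)"
proof (induction p rule: free_alg_induct)
  case (single u c)
  show ?case
    by (induction q rule: free_alg_induct)
       (simp_all add: mult_single act_single word_act_plus word_act_scale
          distrib_left act_plus word_act_add scale_right_distrib)
qed (simp_all add: distrib_right act_plus)

lemma act_in_stable_subspace:
  assumes "subspace K" and "\<And>x v. v \<in> K \<Longrightarrow> \<rho> x v \<in> K" and "v \<in> K"
  shows "act p v \<in> K"
proof -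
  have "word_act w v \<in> K" for w
  proof (cases w)
    case (Word xs)
    have "foldr \<rho> xs v \<in> K" by (induction xs) (simp_all add: assms)
    then show ?thesis by (simp add: Word)
  qed
  then show ?thesis
    unfolding act_def using assms(1) by (intro subspace_sum subspace_scale) auto
qed

text \<open>
  The elements that send given vectors into a submodule form a left ideal. The chain that refutes
  the noetherian property consists of left ideals of this kind, so that membership is decided by a
  computation in a module.
\<close>

lemma left_ideal_act_into:
  assumes K: "subspace K" and stable: "\<And>x v. v \<in> K \<Longrightarrow> \<rho> x v \<in> K"
  shows "left_ideal (free_alg X) {r \<in> carrier (free_alg X). \<forall>v\<in>V. act r v \<in> K}"
    (is "left_ideal ?F ?I")
  unfolding left_ideal_def
proof (intro conjI ballI)
  have "0 \<in> carrier ?F" by (simp add: free_alg_def)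
  then have "subgroup ?I (add_monoid ?F)"
    using subspace_0[OF K] subspace_add[OF K] subspace_neg[OF K]
    by (intro free_alg_subgroupI)
      (auto simp: act_plus act_uminus free_alg_add_closed free_alg_uminus_closed)
  then show "additive_subgroup ?I ?F" by (rule additive_subgroup.intro)
next
  fix r r' assume "r \<in> carrier ?F" "r' \<in> ?I"
  then show "r \<otimes>\<^bsub>?F\<^esub> r' \<in> ?I"
    using act_in_stable_subspace[OF K stable]
    by (auto simp: free_alg_ops act_mult free_alg_mult_closed)
qed

text \<open>
  The elements of the free algebra that annihilate the whole module form a two-sided ideal, which
  is why an action of the generators that respects the defining relations factors through the
  enveloping algebra.
\<close>

lemma act_relation_ideal:
  assumes "uea_relations sc br L \<subseteq> carrier (free_alg L)"
    and add: "\<And>x y v. x \<in> L \<Longrightarrow> y \<in> L \<Longrightarrow> \<rho> (x + y) v = \<rho> x v + \<rho> y v"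
    and sc: "\<And>c x v. x \<in> L \<Longrightarrow> \<rho> (sc c x) v = scale c (\<rho> x v)"
    and br: "\<And>x y v. x \<in> L \<Longrightarrow> y \<in> L \<Longrightarrow> \<rho> (br x y) v = \<rho> x (\<rho> y v) - \<rho> y (\<rho> x v)"
    and p: "p \<in> Idl\<^bsub>free_alg L\<^esub> (uea_relations sc br L)"
  shows "act p v = 0"
proof -
  let ?F = "free_alg L :: ('a free_monoid \<Rightarrow>\<^sub>0 'k) ring"
  let ?I = "{p \<in> carrier ?F. \<forall>v. act p v = 0}"
  interpret F: ring ?F by (rule ring_free_alg)
  have "ideal ?I ?F"
  proof (rule idealI)
    show "subgroup ?I (add_monoid ?F)"
      by (intro free_alg_subgroupI)
        (auto simp: act_plus act_uminus free_alg_add_closed free_alg_uminus_closed,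
         simp add: free_alg_def)
    show "ring ?F" by (rule ring_free_alg)
  qed (auto simp: free_alg_ops act_mult free_alg_mult_closed)
  moreover have "act r v = 0" if "r \<in> uea_relations sc br L" for r v
    using that by (auto simp: uea_relations_def act_minus act_mult add sc br)
  then have "uea_relations sc br L \<subseteq> ?I" using assms(1) by blast
  ultimately have "Idl\<^bsub>?F\<^esub> (uea_relations sc br L) \<subseteq> ?I"
    by (rule F.genideal_minimal)
  then show ?thesis using p by blast
qed

end

section \<open>Chains of left ideals in a quotient ring\<close>

text \<open>
  Left ideals of a ring that contain \<open>J\<close> are determined by their images modulo \<open>J\<close>, so a chain of
  them becomes stationary when its image does.
\<close>

lemma left_noetherian_quotient_chain:
  fixes R (structure)
  assumes "ideal J R" and noeth: "left_noetherian (R Quot J)"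
    and L: "\<And>n::nat. left_ideal R (L n)" and J: "\<And>n. J \<subseteq> L n" and mono: "\<And>n. L n \<subseteq> L (Suc n)"
  obtains N where "\<And>n. n \<ge> N \<Longrightarrow> L n = L N"
proof -
  interpret ideal J R by fact
  let ?\<pi> = "\<lambda>x. J +> x"
  interpret \<pi>: ring_hom_ring R "R Quot J" ?\<pi> by (rule rcos_ring_hom_ring)
  have sub: "subgroup (L n) (add_monoid R)" for n
    using L by (auto simp: left_ideal_def additive_subgroup_def)
  then have carr: "L n \<subseteq> carrier R" for n
    using subgroup.subset[OF sub] by simp
  have surj: "carrier (R Quot J) = ?\<pi> ` carrier R"
    unfolding FactRing_def A_RCOSETS_def' by (simp add: UNION_singleton_eq_range)
  have "left_ideal (R Quot J) (?\<pi> ` L n)" for n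
    unfolding left_ideal_def surj
  proof (intro conjI ballI)
    show "additive_subgroup (?\<pi> ` L n) (R Quot J)"
      by (intro additive_subgroup.intro \<pi>.img_is_add_subgroup sub)
  next
    fix X Y assume "X \<in> ?\<pi> ` carrier R" "Y \<in> ?\<pi> ` L n"
    then obtain x y where xy: "x \<in> carrier R" "y \<in> L n" "X = ?\<pi> x" "Y = ?\<pi> y" by auto
    then have "X \<otimes>\<^bsub>R Quot J\<^esub> Y = ?\<pi> (x \<otimes> y)" using subsetD[OF carr xy(2)] by (simp add: \<pi>.hom_mult)
    then show "X \<otimes>\<^bsub>R Quot J\<^esub> Y \<in> ?\<pi> ` L n" using L[of n] xy by (auto simp: left_ideal_def)
  qed
  moreover have "?\<pi> ` L n \<subseteq> ?\<pi> ` L (Suc n)" for n using mono by blast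
  ultimately have "\<exists>N. \<forall>n\<ge>N. ?\<pi> ` L n = ?\<pi> ` L N"
    by (intro noeth[unfolded left_noetherian_def, rule_format]) auto
  then obtain N where N: "?\<pi> ` L n = ?\<pi> ` L N" if "n \<ge> N" for n by blast
  have reflect: "L m \<subseteq> L n" if eq: "?\<pi> ` L m = ?\<pi> ` L n" for m n
  proof
    fix x assume x: "x \<in> L m"
    then obtain y where y: "y \<in> L n" "?\<pi> x = ?\<pi> y" using eq by blast
    then have "x \<in> ?\<pi> y" using a_rcos_self x carr by blast
    then obtain j where "j \<in> J" "x = j \<oplus> y" by (auto simp: a_r_coset_def')
    then show "x \<in> L n" using subgroup.m_closed[OF sub] J y by fastforce
  qed
  show thesis
    by (rule that[of N]) (intro subset_antisym reflect N N[symmetric])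
qed

section \<open>A family of tensor density modules\<close>

text \<open>The derivation \<open>t d/dt\<close>, which is diagonal on monomials.\<close>

definition euler :: "'c::comm_ring_1 fls \<Rightarrow> 'c fls"
  where "euler v = fls_X * fls_deriv v"

lemma euler_nth [simp]: "euler v $$ n = of_int n * v $$ n"
  by (simp add: euler_def fls_X_times_conv_shift)

lemma euler_add: "euler (v + w) = euler v + euler w"
  by (intro fls_eqI) (simp add: algebra_simps)

lemma euler_diff: "euler (v - w) = euler v - euler w"
  by (intro fls_eqI) (simp add: algebra_simps)

lemma euler_mult: "euler (v * w) = euler v * w + v * euler w"
  by (simp add: euler_def algebra_simps)

lemma euler_const [simp]: "euler (fls_const c) = 0"
  by (intro fls_eqI) auto

lemma euler_const_mult [simp]: "euler (fls_const c * v) = fls_const c * euler v"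
  by (intro fls_eqI) (simp add: algebra_simps)

abbreviation param :: "'k::comm_ring_1 poly fls"
  where "param \<equiv> fls_const [:0, 1:]"

text \<open>
  The series \<open>f/t\<close>, so that \<open>f\<partial>\<close> is \<open>symbol f\<close> times the Euler derivation. The coefficients are
  embedded in \<open>k[a]\<close> as constants; the parameter \<open>a\<close> is the variable of the inner polynomial ring.
\<close>

definition symbol :: "'k::comm_ring_1 poly \<Rightarrow> 'k poly fls"
  where "symbol f = fls_X_inv * fps_to_fls (Abs_fps (\<lambda>n. [:coeff f n:]))"

text \<open>
  This is the Lie derivative along \<open>f\<partial>\<close>, when \<open>v\<close> stands for the density
  \<open>t\<^sup>-\<^sup>1\<^sup>-\<^sup>a v (dt)\<^sup>1\<^sup>+\<^sup>a\<close>. The factor \<open>t\<^sup>-\<^sup>1\<^sup>-\<^sup>a\<close> is chosen so that, for \<open>a = 0\<close>, it is the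
  coefficient of \<open>t\<^sup>0\<close> that vanishes in every image under a vector field.
\<close>

definition density :: "'k::comm_ring_1 poly \<Rightarrow> 'k poly fls \<Rightarrow> 'k poly fls"
  where "density f v = euler (symbol f * v) + param * euler (symbol f) * v"

abbreviation fls_scale :: "'k::comm_ring_1 \<Rightarrow> 'k poly fls \<Rightarrow> 'k poly fls"
  where "fls_scale c v \<equiv> fls_const [:c:] * v"

lemma symbol_nth: "symbol f $$ n = (if n \<ge> -1 then [:coeff f (nat (n + 1)):] else 0)"
  by (simp add: symbol_def fls_X_inv_times_conv_shift)

lemma symbol_add: "symbol (f + g) = symbol f + symbol g"
  by (intro fls_eqI) (simp add: symbol_nth)

lemma symbol_smult: "symbol (smult c f) = fls_scale c (symbol f)"
  by (intro fls_eqI) (simp add: symbol_nth)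

lemma symbol_e:
  assumes "n \<ge> -1"
  shows "symbol (witt_e n) = fls_X_intpow n"
  using assms by (intro fls_eqI) (auto simp: symbol_nth witt_e_def)

lemma symbol_bracket:
  "symbol (witt_bracket f g) = symbol f * euler (symbol g) - euler (symbol f) * symbol g"
proof -
  \<comment> \<open>The embedding \<open>P\<close> of \<open>k[t]\<close> is a ring homomorphism that commutes with differentiation. The
    Euler derivative of \<open>f/t\<close> is \<open>f' - f/t\<close>, and the terms \<open>f g / t\<^sup>2\<close> that this produces cancel.\<close>
  define P :: "'a poly \<Rightarrow> 'a poly fls" where "P f = fps_to_fls (Abs_fps (\<lambda>n. [:coeff f n:]))" for f
  have sum: "(\<Sum>i\<in>A. [:h i:]) = [:sum h A:]" for h :: "nat \<Rightarrow> 'a" and A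
    by (induction A rule: infinite_finite_induct) auto
  have mult: "P (p * q) = P p * P q" for p q
    unfolding P_def fls_times_fps_to_fls[symmetric] fps_to_fls_eq_iff
  proof (intro fps_ext)
    fix n
    have "[:coeff (p * q) n:] = (\<Sum>i\<le>n. [:coeff p i:] * [:coeff q (n - i):])"
      by (simp only: coeff_mult sum[symmetric]) (simp add: mult.commute)
    then show "Abs_fps (\<lambda>n. [:coeff (p * q) n:]) $ n =
        (Abs_fps (\<lambda>n. [:coeff p n:]) * Abs_fps (\<lambda>n. [:coeff q n:])) $ n"
      by (simp only: fps_mult_nth fps_nth_Abs_fps atLeast0AtMost)
  qed
  have diff: "P (p - q) = P p - P q" for p q
    unfolding P_def fps_to_fls_minus[symmetric] fps_to_fls_eq_iff
    by (intro fps_ext) simp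
  have deriv: "P (pderiv p) = fls_deriv (P p)" for p
    unfolding P_def fls_deriv_fps_to_fls fps_to_fls_eq_iff
    by (intro fps_ext) (simp add: coeff_pderiv of_nat_poly)
  have euler: "euler (symbol p) = fls_deriv (P p) - symbol p" for p
    by (intro fls_eqI)
      (simp add: symbol_def P_def[symmetric] fls_X_inv_times_conv_shift algebra_simps)
  have "symbol (witt_bracket f g) = symbol f * fls_deriv (P g) - fls_deriv (P f) * symbol g"
    by (simp only: symbol_def P_def[symmetric] witt_bracket_def mult diff deriv)
      (simp add: algebra_simps)
  then show ?thesis by (simp add: euler algebra_simps)
qed

text \<open>
  The terms quadratic in \<open>a\<close> are symmetric in \<open>f\<close> and \<open>g\<close>, and the others match by the product rule
  for the Euler derivation.
\<close>

lemma density_bracket: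
  "density (witt_bracket f g) v = density f (density g v) - density g (density f v)"
  by (simp add: density_def symbol_bracket euler_add euler_diff euler_mult algebra_simps)

lemma density_add: "density (f + g) v = density f v + density g v"
  by (simp add: density_def symbol_add euler_add algebra_simps)

lemma density_smult: "density (smult c f) v = fls_scale c (density f v)"
  by (simp only: density_def symbol_smult euler_const_mult distrib_left mult.assoc
    mult.left_commute[of "fls_const [:c:]" param])

lemma density_const_mult: "density f (fls_const c * v) = fls_const c * density f v"
proof -
  have "symbol f * (fls_const c * v) = fls_const c * (symbol f * v)" by (rule mult.left_commute)
  then show ?thesis by (simp only: density_def euler_const_mult distrib_left mult.left_commute)
qed

lemma density_e:
  fixes c :: "'k::field_char_0 poly"
  assumes "n \<ge> -1"
  shows "density (witt_e n) (fls_const c * fls_X_intpow m) =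
    fls_const ([:of_int (n + m), of_int n:] * c) * fls_X_intpow (n + m)"
proof -
  have X: "fls_X_intpow i * fls_X_intpow j = (fls_X_intpow (i + j) :: 'k poly fls)" for i j
    by (rule fls_X_intpow_times_fls_X_intpow)
  have euler_X: "euler (fls_X_intpow i) = fls_const (of_int i) * (fls_X_intpow i :: 'k poly fls)" for i
    by (intro fls_eqI) auto
  have "density (witt_e n) (fls_const c * fls_X_intpow m) =
      fls_const c * euler (fls_X_intpow n * fls_X_intpow m) +
      param * fls_const (of_int n) * fls_const c * (fls_X_intpow n * fls_X_intpow m)"
    unfolding density_def symbol_e[OF assms] euler_X
    by (simp only: mult_ac euler_const_mult)
  also have "\<dots> = fls_const (c * of_int (n + m) + [:0, 1:] * of_int n * c) * fls_X_intpow (n + m)"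
    by (simp only: X euler_X fls_const_mult_const fls_plus_const distrib_right[symmetric] mult.assoc[symmetric])
  also have "c * of_int (n + m) + [:0, 1:] * of_int n * c = [:of_int (n + m), of_int n:] * c"
    by (simp add: of_int_poly algebra_simps smult_add_left)
  finally show ?thesis .
qed

interpretation density: generator_action fls_scale
  "density :: 'k::field_char_0 poly \<Rightarrow> 'k poly fls \<Rightarrow> 'k poly fls"
proof
  fix a b :: 'k and x y :: "'k poly fls" and f :: "'k poly"
  show "fls_scale a (x + y) = fls_scale a x + fls_scale a y" by (rule distrib_left)
  show "fls_scale (a + b) x = fls_scale a x + fls_scale b x"
    by (intro fls_eqI) (simp add: algebra_simps smult_add_left)
  show "fls_scale a (fls_scale b x) = fls_scale (a * b) x"
    by (intro fls_eqI) simp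
  show "fls_scale 1 x = x" by (intro fls_eqI) simp
  show "density f (x + y) = density f x + density f y"
    by (simp add: density_def euler_add algebra_simps)
  show "density f (fls_scale a x) = fls_scale a (density f x)"
    by (rule density_const_mult)
qed

text \<open>
  In the layer of multiples of \<open>a\<close> modulo \<open>a\<^sup>2\<close>, the action is that of \<open>a = 0\<close>. There the constant
  coefficient of every image vanishes, so that the condition on the constant coefficient is stable.
\<close>

definition critical :: "'k::field_char_0 poly fls set"
  where "critical = {v. (\<forall>n. [:0, 1:] dvd v $$ n) \<and> [:0, 1:]\<^sup>2 dvd v $$ 0}"

lemma critical_subspace: "density.subspace critical"
  by (simp add: density.subspace_def critical_def dvd_smult)

lemma critical_iff: "v \<in> critical \<longleftrightarrow> (\<exists>w. v = param * w \<and> [:0, 1:] dvd w $$ 0)"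
proof
  assume v: "v \<in> critical"
  define w where "w = Abs_fls (\<lambda>n. v $$ n div [:0, 1:])"
  obtain N where "\<forall>n<N. v $$ n = 0" by (elim fls_nth_vanishes_belowE)
  then have w: "w $$ n = v $$ n div [:0, 1:]" for n
    unfolding w_def by (intro nth_Abs_fls_lower_bound[of N]) simp
  have "v = param * w"
    using v by (intro fls_eqI) (simp only: fls_mult_const_nth w critical_def mem_Collect_eq dvd_mult_div_cancel)
  moreover have "[:0, 1:] dvd w $$ 0"
  proof -
    have "[:0, 1:] * [:0, 1:] dvd [:0, 1:] * w $$ 0"
      using v \<open>v = param * w\<close>
      by (simp only: critical_def mem_Collect_eq power2_eq_square fls_mult_const_nth)
    then show ?thesis by (subst (asm) dvd_mult_cancel_left) simp
  qed
  ultimately show "\<exists>w. v = param * w \<and> [:0, 1:] dvd w $$ 0" by blast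
next
  assume "\<exists>w. v = param * w \<and> [:0, 1:] dvd w $$ 0"
  then obtain w where "v = param * w" and w: "[:0, 1:] dvd w $$ 0" by blast
  moreover have "[:0, 1:]\<^sup>2 dvd [:0, 1:] * w $$ 0"
    unfolding power2_eq_square using w by (rule mult_dvd_mono[OF dvd_refl])
  ultimately show "v \<in> critical"
    by (simp only: critical_def mem_Collect_eq fls_mult_const_nth dvd_triv_left simp_thms)
qed

text \<open>
  For \<open>v = a w\<close> the image is \<open>a\<close> times the image of \<open>w\<close>, and the constant coefficient of the latter
  comes from its second summand alone, which carries another factor \<open>a\<close>.
\<close>

lemma critical_density:
  assumes "v \<in> critical"
  shows "density f v \<in> critical"
proof -
  obtain w where v: "v = param * w" using assms critical_iff by blast
  have "density f v = param * density f w"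
    by (simp only: v density_const_mult)
  moreover have "density f w $$ 0 = [:0, 1:] * (euler (symbol f) * w) $$ 0"
    by (simp add: density_def mult.assoc del: mult_pCons_left)
  ultimately show ?thesis unfolding critical_iff by (metis dvd_triv_left)
qed

lemma monomial_critical_iff:
  "fls_const c * fls_X_intpow n \<in> critical \<longleftrightarrow> [:0, 1:] dvd c \<and> (n = 0 \<longrightarrow> [:0, 1:]\<^sup>2 dvd c)"
  by (auto simp: critical_def dvd_def power2_eq_square simp del: mult_pCons_left)

section \<open>Second differences of products\<close>

definition second_difference :: "int \<Rightarrow> int \<Rightarrow> int \<Rightarrow> ('k::field_char_0 poly free_monoid \<Rightarrow>\<^sub>0 'k)"
  where "second_difference p q N =
    gen (witt_e p) * gen (witt_e (N - p))
    - scalar 2 * (gen (witt_e (p + q)) * gen (witt_e (N - (p + q))))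
    + gen (witt_e (p + 2 * q)) * gen (witt_e (N - (p + 2 * q)))"

text \<open>
  With \<open>x = N + m\<close>, the product \<open>e\<^sub>i e\<^sub>N\<^sub>-\<^sub>i\<close> multiplies \<open>t\<^sup>m\<close> by \<open>(x + a i)(x - i + a(N - i)) t\<^sup>N\<close>.
  The coefficient of \<open>i\<^sup>2\<close> is \<open>-a(1 + a)\<close>, and the second difference with step \<open>q\<close> multiplies it by
  \<open>2q\<^sup>2\<close>; the terms of lower degree in \<open>i\<close> disappear, and with them the dependence of the factor
  on \<open>m\<close>.
\<close>

lemma act_second_difference:
  assumes "p \<ge> -1" "q \<ge> 0" "N - (p + 2 * q) \<ge> -1"
  shows "density.act (second_difference p q N :: 'k::field_char_0 poly free_monoid \<Rightarrow>\<^sub>0 'k) (fls_X_intpow m) =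
    fls_const (smult (- 2 * of_int q ^ 2) ([:0, 1:] * [:1, 1:])) * fls_X_intpow (N + m)"
proof -
  have pair: "density (witt_e i) (density (witt_e (N - i)) (fls_X_intpow m)) =
      fls_const ([:of_int (N + m), of_int i:] * [:of_int (N - i + m), of_int (N - i):] :: 'k poly)
        * fls_X_intpow (N + m)"
    if "i \<ge> -1" "N - i \<ge> -1" for i
  proof -
    have "density (witt_e (N - i)) (fls_X_intpow m) =
        fls_const [:of_int (N - i + m), of_int (N - i) :: 'k:] * fls_X_intpow (N - i + m)"
      using density_e[OF that(2), of 1 m] by (simp only: fls_const_1 mult_1_left mult_1_right)
    moreover have "i + (N - i + m) = N + m" by simp
    ultimately show ?thesis by (simp only: density_e[OF that(1)])
  qed
  let ?c = "\<lambda>i. [:of_int (N + m), of_int i:] * [:of_int (N - i + m), of_int (N - i):] :: 'k poly"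
  have "density.act (second_difference p q N) (fls_X_intpow m) =
      fls_const (?c p - smult 2 (?c (p + q)) + ?c (p + 2 * q)) * fls_X_intpow (N + m)"
    using assms
    by (simp add: second_difference_def density.act_plus density.act_minus density.act_mult pair
       del: mult_pCons_left mult_pCons_right)
      (intro fls_eqI, simp)
  also have "?c p - smult 2 (?c (p + q)) + ?c (p + 2 * q) = smult (- 2 * of_int q ^ 2) ([:0, 1:] * [:1, 1:])"
    by (simp add: algebra_simps power2_eq_square)
  finally show ?thesis .
qed

lemma second_difference_critical_iff:
  assumes "p \<ge> -1" "q > 0" "N - (p + 2 * q) \<ge> -1"
  shows "density.act (second_difference p q N :: 'k::field_char_0 poly free_monoid \<Rightarrow>\<^sub>0 'k) (fls_X_intpow m) \<in> critical
    \<longleftrightarrow> N + m \<noteq> 0"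
proof -
  let ?c = "- 2 * of_int q ^ 2 :: 'k"
  have "\<not> [:0, 1:]\<^sup>2 dvd smult ?c ([:0, 1:] * [:1, 1:])"
  proof
    assume "[:0, 1:]\<^sup>2 dvd smult ?c ([:0, 1:] * [:1, 1:])"
    then have "[:0, 1:] * [:0, 1:] dvd [:0, 1:] * smult ?c [:1, 1:]"
      by (simp only: power2_eq_square mult_smult_right)
    then have "[:0, 1:] dvd smult ?c [:1, 1:]"
      by (subst (asm) dvd_mult_cancel_left) simp
    then have "poly (smult ?c [:1, 1:]) 0 = 0" by (auto simp: dvd_def)
    then show False using assms(2) by simp
  qed
  moreover have "[:0, 1:] dvd smult ?c ([:0, 1:] * [:1, 1:])"
    by (intro dvd_smult dvd_triv_left)
  ultimately show ?thesis
    using assms by (subst act_second_difference) (simp_all only: monomial_critical_iff order.strict_implies_order, simp)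
qed

section \<open>Degrees occurring in a graded subalgebra\<close>

text \<open>
  Each homogeneous component of the Witt algebra is one-dimensional, so a graded subalgebra is
  spanned by the \<open>e\<^sub>n\<close> that it contains.
\<close>

lemma graded_degrees_infinite:
  fixes \<gg> :: "'k::field_char_0 poly set"
  assumes "graded_lie_subalgebra \<gg>" and "\<not> finite_dimensional \<gg>"
  shows "infinite {n. n \<ge> -1 \<and> witt_e n \<in> \<gg>}" (is "infinite ?S")
proof
  assume fin: "finite ?S"
  have sub: "poly_vs.subspace \<gg>"
    using assms(1) by (simp add: graded_lie_subalgebra_def lie_subalgebra_def)
  have "f \<in> poly_vs.span (witt_e ` ?S)" if f: "f \<in> \<gg>" "homogeneous n f" for f :: "'k poly" and n
  proof -
    obtain c where n: "n \<ge> -1" and c: "f = smult c (witt_e n)" using f by (auto simp: homogeneous_def)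
    show ?thesis
    proof (cases "c = 0")
      case True
      then show ?thesis by (simp add: c poly_vs.span_zero)
    next
      case False
      then have "witt_e n = smult (inverse c) f" by (simp add: c)
      then have "witt_e n \<in> \<gg>" using poly_vs.subspace_scale[OF sub f(1)] by simp
      then show ?thesis
        unfolding c using n by (intro poly_vs.span_scale poly_vs.span_base) auto
    qed
  qed
  then have "poly_vs.span {f \<in> \<gg>. \<exists>n. homogeneous n f} \<subseteq> poly_vs.span (witt_e ` ?S)"
    by (intro poly_vs.span_minimal) auto
  moreover have "poly_vs.span (witt_e ` ?S) \<subseteq> \<gg>"
    using sub by (intro poly_vs.span_minimal) auto
  ultimately have "poly_vs.span (witt_e ` ?S) = \<gg>"
    using assms(1) by (auto simp: graded_lie_subalgebra_def)
  then show False
    using assms(2) fin unfolding finite_dimensional_def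
    by (metis (no_types, lifting) finite_imageI image_subsetI mem_Collect_eq)
qed

text \<open>
  Bracketing with \<open>e\<^sub>q\<close> raises the degree by \<open>q\<close>, with the factor \<open>p + kq - q\<close>. For \<open>k = 0\<close> this is
  nonzero because \<open>p\<close> and \<open>q\<close> are distinct, and for larger \<open>k\<close> because it is positive; it
  stays nonzero as a scalar because the characteristic is \<open>0\<close>.
\<close>

lemma arithmetic_progression_of_degrees:
  fixes \<gg> :: "'k::field_char_0 poly set"
  assumes g: "lie_subalgebra \<gg>" and "witt_e p \<in> \<gg>" "witt_e q \<in> \<gg>" "p > 0" "q > 0" "p \<noteq> q"
  shows "witt_e (p + int k * q) \<in> \<gg>"
proof (induction k)
  case 0
  then show ?case using assms by simp
next
  case (Suc k)
  let ?c = "of_int (p + int k * q - q) :: 'k"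
  have "p + int k * q - q \<noteq> 0"
  proof (cases k)
    case (Suc l)
    then have "p + int k * q - q = p + int l * q" by (simp add: algebra_simps)
    also have "\<dots> > 0" using assms by (simp add: add_pos_nonneg)
    finally show ?thesis by simp
  qed (use assms in simp)
  then have c: "?c \<noteq> 0" by (simp only: of_int_eq_0_iff not_False_eq_True)
  have "p + int k * q \<ge> 0" using assms by simp
  then have "witt_bracket (witt_e q) (witt_e (p + int k * q)) = smult ?c (witt_e (q + (p + int k * q)))"
    using assms by (intro witt_bracket_e) linarith+
  moreover have "q + (p + int k * q) = p + int (Suc k) * q" by (simp add: algebra_simps)
  ultimately have "smult ?c (witt_e (p + int (Suc k) * q)) \<in> \<gg>"
    using g Suc assms(3) unfolding lie_subalgebra_def by metis
  then have "smult (inverse ?c) (smult ?c (witt_e (p + int (Suc k) * q))) \<in> \<gg>"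
    using g poly_vs.subspace_scale by (metis lie_subalgebra_def)
  then show ?case by (simp only: smult_smult left_inverse[OF c] smult_1_left)
qed

section \<open>A strictly increasing chain of left ideals\<close>

theorem proposition3p9:
  fixes \<gg> :: "'k::field_char_0 poly set"
  assumes "graded_lie_subalgebra \<gg>" and "\<not> finite_dimensional \<gg>"
  shows "\<not> noetherian (uea smult witt_bracket \<gg>)"
proof
  assume noeth: "noetherian (uea smult witt_bracket \<gg>)"
  let ?F = "free_alg \<gg> :: ('k poly free_monoid \<Rightarrow>\<^sub>0 'k) ring"
  let ?J = "Idl\<^bsub>?F\<^esub> (uea_relations smult witt_bracket \<gg>)"
  have noeth: "left_noetherian (?F Quot ?J)"
    using noeth by (simp add: noetherian_def uea_def)
  interpret F: ring ?F by (rule ring_free_alg)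
  have lie: "lie_subalgebra \<gg>" using assms(1) by (simp add: graded_lie_subalgebra_def)
  have rel: "uea_relations smult witt_bracket \<gg> \<subseteq> carrier ?F"
    using lie by (intro uea_relations_carrier)
      (auto simp: lie_subalgebra_def intro: poly_vs.subspace_add poly_vs.subspace_scale)
  then have J: "ideal ?J ?F" by (rule F.genideal_ideal)
  have act_J: "density.act r v = 0" if "r \<in> ?J" for r v
    using density.act_relation_ideal[OF rel density_add density_smult density_bracket that] .

  \<comment> \<open>Fewer conditions remain as \<open>n\<close> grows; the element \<open>s\<close> below violates just the one for \<open>j = M\<close>.\<close>
  define L where "L n = {r \<in> carrier ?F. \<forall>j>int n. density.act r (fls_X_intpow (- j)) \<in> critical}" for n
  have "left_ideal ?F (L n)" for n
  proof -
    have "L n = {r \<in> carrier ?F. \<forall>v \<in> (\<lambda>j. fls_X_intpow (- j)) ` {int n<..}. density.act r v \<in> critical}"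
      by (auto simp: L_def)
    then show ?thesis
      by (simp only: density.left_ideal_act_into[OF critical_subspace critical_density])
  qed
  moreover have "?J \<subseteq> L n" for n
    using act_J ideal.Icarr[OF J] density.subspace_0[OF critical_subspace] by (auto simp: L_def)
  moreover have "L n \<subseteq> L (Suc n)" for n
    by (auto simp: L_def)
  ultimately obtain N where N: "L n = L N" if "n \<ge> N" for n
    using left_noetherian_quotient_chain[OF J noeth, of L] by blast

  let ?S = "{n. n \<ge> -1 \<and> (witt_e n :: 'k poly) \<in> \<gg>}"
  have S: "?S - A \<noteq> {}" if "finite A" for A
    using Diff_infinite_finite[OF that graded_degrees_infinite[OF assms]] infinite_imp_nonempty by blast
  obtain p where p: "p \<in> ?S - {-1, 0}" using S[of "{-1, 0}"] by blast
  obtain q where q: "q \<in> ?S - {-1, 0, p}" using S[of "{-1, 0, p}"] by blast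
  have pq: "p > 0" "q > 0" "p \<noteq> q" "witt_e p \<in> \<gg>" "witt_e q \<in> \<gg>" using p q by auto
  note deg = arithmetic_progression_of_degrees[OF lie pq(4,5,1,2,3)]
  \<comment> \<open>The three products in the second difference pair the degrees \<open>p\<close>, \<open>p + q\<close>, \<open>p + 2q\<close> with
    \<open>p + (N + 2)q\<close>, \<open>p + (N + 1)q\<close>, \<open>p + Nq\<close>, which are all available; \<open>N\<close> appears in \<open>M\<close> only to
    make \<open>M\<close> exceed it.\<close>
  define M where "M = 2 * p + (int N + 2) * q"
  define s where "s = (second_difference p q M :: 'k poly free_monoid \<Rightarrow>\<^sub>0 'k)"
  have "int N * q \<ge> int N" using pq by (simp add: mult_le_cancel_left1)
  moreover have "M = 2 * p + int N * q + 2 * q" by (simp add: M_def algebra_simps)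
  ultimately have M: "M > int N" "M - (p + 2 * q) \<ge> -1"
    using pq by linarith+
  have "witt_e p \<in> \<gg>" "witt_e (p + q) \<in> \<gg>" "witt_e (p + 2 * q) \<in> \<gg>"
    "witt_e (M - p) \<in> \<gg>" "witt_e (M - (p + q)) \<in> \<gg>" "witt_e (M - (p + 2 * q)) \<in> \<gg>"
    using deg[of 0] deg[of 1] deg[of 2] deg[of "N + 2"] deg[of "N + 1"] deg[of N]
    by (simp_all add: M_def algebra_simps)
  then have s: "s \<in> carrier ?F"
    unfolding s_def second_difference_def
    by (intro free_alg_add_closed free_alg_diff_closed free_alg_mult_closed gen_closed scalar_closed)
  have crit: "density.act s (fls_X_intpow (- m)) \<in> critical \<longleftrightarrow> m \<noteq> M" for m
    using second_difference_critical_iff[of p q M "- m"] pq M by (auto simp: s_def)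
  have "s \<in> L (nat M)" unfolding L_def using s crit by auto
  moreover have "s \<notin> L N" unfolding L_def using crit[of M] M(1) by blast
  ultimately show False using N[of "nat M"] M by simp
qed

end
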